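(* For positive integers $\theta_1,\theta_2,\ldots,\theta_d$, $$h^\ast_{P_d(\theta_1,\ldots,\theta_d)}(t)=\mathcal{A}\left(\prod_{i=1}^d(\theta_it+1)\right).$$
   Context: For $n\ge 0$, the $n$-th Eulerian polynomial is $A_n(t)=\sum_{k=0}^n A_{nk}t^k$, where $A_{nk}$ is the number of permutations $\sigma$ of $\{1,\dots,n\}$ such that $\sigma(i)\ge i$ for exactly $k$ indices $i$ (so $A_0(t)=1$). The map $\mathcal{A}:\mathbb{R}[t]\to\mathbb{R}[t]$ is the $\mathbb{R}$-linear operator determined by $\mathcal{A}(t^n)=A_n(t)$ for all $n\ge 0$. For positive integers $\theta_1,\ldots,\theta_d$, $P_d(\theta_1,\ldots,\theta_d)\subset\mathbb{R}^d$ is the $d$-dimensional lattice polytope $$P_d(\theta_1,\ldots,\theta_d)=\mathrm{conv}\bigl((-\Delta_d)\cup Q_d(\theta_1,\ldots,\theta_d)\bigr),$$ where $\Delta_d=\mathrm{conv}(\mathbf{0},\mathbf{e}_1,\ldots,\mathbf{e}_d)$ is the standard simplex ($\mathbf{e}_i$ the standard basis vectors) and $Q_d(\theta_1,\ldots,\theta_d)=\{\mathbf{x}\in\mathbb{R}^d:0\le x_i\le\theta_i\text{ for all }1\le i\le d\}$. For a $d$-dimensional lattice polytope $P\subset\mathbb{R}^d$ (convex hull of finitely many points of $\mathbb{Z}^d$), the number $|nP\cap\mathbb{Z}^d|$ agrees for all integers $n\ge 0$ with a polynomial $E_P(n)$ of degree $d$ (the Ehrhart polynomial). The numbers $h_0(P),\ldots,h_d(P)$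 are defined by $$E_P(n)=h_0(P)\binom{n+d}{d}+h_1(P)\binom{n+d-1}{d}+\cdots+h_d(P)\binom{n}{d},$$ and the $h^\ast$-polynomial of $P$ is $h^\ast_P(t)=h_0(P)+h_1(P)t+\cdots+h_d(P)t^d$. *)

theory Defs
  imports "HOL-Analysis.Analysis" "HOL-Computational_Algebra.Polynomial"
    "HOL-Combinatorics.Permutations"
begin

definition eulerian_num :: "nat \<Rightarrow> nat \<Rightarrow> nat" where
  "eulerian_num n k =
     card {\<sigma>. \<sigma> permutes {1..n} \<and> card {i \<in> {1..n}. \<sigma> i \<ge> i} = k}"

definition eulerian_poly :: "nat \<Rightarrow> real poly" where
  "eulerian_poly n = (\<Sum>k\<le>n. monom (real (eulerian_num n k)) k)"

text \<open>The real-linear operator sending \<open>t\<^sup>n\<close> to \<open>eulerian_poly n\<close>; the lemmas below show that it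
  is linear and has the prescribed values on monomials.\<close>

definition eulerian_map :: "real poly \<Rightarrow> real poly" where
  "eulerian_map p = (\<Sum>n\<le>degree p. smult (coeff p n) (eulerian_poly n))"

lemma eulerian_map_bound:
  assumes "degree p \<le> N"
  shows "eulerian_map p = (\<Sum>n\<le>N. smult (coeff p n) (eulerian_poly n))"
  unfolding eulerian_map_def
  by (rule sum.mono_neutral_left) (use assms in \<open>auto simp: coeff_eq_0\<close>)

lemma eulerian_map_add: "eulerian_map (p + q) = eulerian_map p + eulerian_map q"
proof -
  define N where "N = max (degree p) (degree q)"
  have "degree p \<le> N" "degree q \<le> N" "degree (p + q) \<le> N"
    by (auto simp: N_def intro: degree_add_le)
  then show ?thesis
    by (simp add: eulerian_map_bound[where N = N] smult_add_left sum.distrib)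
qed

lemma eulerian_map_smult: "eulerian_map (smult c p) = smult c (eulerian_map p)"
proof -
  have "eulerian_map (smult c p) = (\<Sum>n\<le>degree p. [:c:] * smult (coeff p n) (eulerian_poly n))"
    by (simp add: eulerian_map_bound[where N = "degree p"] degree_smult_le mult.commute)
  also have "\<dots> = smult c (eulerian_map p)"
    unfolding eulerian_map_def sum_distrib_left[symmetric] by simp
  finally show ?thesis .
qed

lemma eulerian_map_monom: "eulerian_map (monom 1 n) = eulerian_poly n"
proof -
  have "eulerian_map (monom 1 n) = (\<Sum>k\<le>n. if k = n then eulerian_poly n else 0)"
    unfolding eulerian_map_def by (rule sum.cong) (auto simp: degree_monom_eq)
  then show ?thesis by simp
qed

definition integer_lattice :: "(real ^ 'n) set" where
  "integer_lattice = {x. \<forall>i. x $ i \<in> \<int>}"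

text \<open>A polynomial is determined by its values on the natural numbers, so there is at most one
  candidate; for lattice polytopes it exists by Ehrhart's theorem.\<close>

definition ehrhart_poly :: "(real ^ 'n) set \<Rightarrow> real poly" where
  "ehrhart_poly P =
     (THE E. \<forall>n::nat. poly E (real n) = real (card ((\<lambda>x. real n *\<^sub>R x) ` P \<inter> integer_lattice)))"

text \<open>Meant for full-dimensional lattice polytopes \<open>P\<close>, so that \<open>d = CARD('n)\<close> is the dimension
  of \<open>P\<close>. As \<open>j \<le> d\<close>, the natural-number subtraction below does not truncate.\<close>

definition hstar_poly :: "(real ^ 'n) set \<Rightarrow> real poly" where
  "hstar_poly P =
     (THE h. degree h \<le> CARD('n) \<and>
        (\<forall>n::nat. poly (ehrhart_poly P) (real n) =
           (\<Sum>j\<le>CARD('n). coeff h j * real ((n + CARD('n) - j) choose CARD('n)))))"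

definition std_simplex :: "(real ^ 'n) set" where
  "std_simplex = convex hull (insert 0 (range (\<lambda>i. axis i 1)))"

definition box_Q :: "('n \<Rightarrow> nat) \<Rightarrow> (real ^ 'n) set" where
  "box_Q \<theta> = {x. \<forall>i. 0 \<le> x $ i \<and> x $ i \<le> real (\<theta> i)}"

definition polytope_P :: "('n \<Rightarrow> nat) \<Rightarrow> (real ^ 'n) set" where
  "polytope_P \<theta> = convex hull (uminus ` std_simplex \<union> box_Q \<theta>)"

end

theory Submission
  imports Defs "HOL-Computational_Algebra.Polynomial_FPS"
begin

text \<open>
  Write \<open>P\<close> for the polytope, \<open>d\<close> for its dimension and \<open>p(t) = \<Prod>\<^sub>i (1 + \<theta>\<^sub>i t) = \<Sum>\<^sub>j c\<^sub>j t\<^sup>j\<close>.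
  The \<open>h\<close>-star polynomial is characterised by \<open>\<Sum>\<^sub>n E\<^sub>P(n) X\<^sup>n = h(X) / (1 - X)\<^sup>d\<^sup>+\<^sup>1\<close>, so the
  proof computes the generating function of the lattice point counts of the dilates \<open>nP\<close>.

  A point of the convex hull is a point of the box pushed down by a vector of total weight \<open>u\<close>, at
  the price of shrinking the box by the factor \<open>1 - u\<close>.  The cheapest way to reach an integer
  point \<open>y\<close> of \<open>nP\<close> pushes only its negative coordinates.  Hence, with \<open>m\<close> the sum of the absolute
  values of these coordinates, \<open>y\<close> lies in \<open>nP\<close> iff \<open>m \<le> n\<close> and every coordinate satisfies
  \<open>y\<^sub>i \<le> \<theta>\<^sub>i (n - m)\<close> (\<open>int_point_mem_dilate_iff\<close>).

  Fix \<open>k = n - m\<close>.  The coordinates are now independent, and marking the weight \<open>m\<close> by \<open>X\<close> a single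
  coordinate contributes \<open>\<theta>\<^sub>i k + G\<close> with \<open>G = 1 / (1 - X)\<close>: there are \<open>\<theta>\<^sub>i k\<close> positive values of
  weight 0, and one value \<open>- m\<close> of each weight \<open>m\<close>.  Expanding the product gives
  \<open>\<Prod>\<^sub>i (\<theta>\<^sub>i k + G) = \<Sum>\<^sub>j c\<^sub>j k\<^sup>j G\<^sup>d\<^sup>-\<^sup>j\<close> (\<open>prod_homogenize\<close>).  Multiplying by \<open>X\<^sup>k\<close> and summing over \<open>k\<close>,
  Euler's identity \<open>\<Sum>\<^sub>k k\<^sup>j X\<^sup>k = A\<^sub>j(X) G\<^sup>j\<^sup>+\<^sup>1\<close> (\<open>fps_powers_eq_eulerian\<close>) turns this into
  \<open>\<Sum>\<^sub>j c\<^sub>j A\<^sub>j(X) G\<^sup>d\<^sup>+\<^sup>1\<close>, whose numerator is the image of \<open>p\<close> under the Eulerian map.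
\<close>

section \<open>Eulerian polynomials\<close>

definition weak_exc :: "nat \<Rightarrow> (nat \<Rightarrow> nat) \<Rightarrow> nat" where
  "weak_exc n \<sigma> = card {i \<in> {1..n}. \<sigma> i \<ge> i}"

lemma weak_exc_le: "weak_exc n \<sigma> \<le> n"
proof -
  have "card {i \<in> {1..n}. \<sigma> i \<ge> i} \<le> card {1..n}"
    by (rule card_mono) auto
  then show ?thesis by (simp add: weak_exc_def)
qed

lemma eulerian_poly_as_sum:
  "eulerian_poly n = (\<Sum>\<sigma> | \<sigma> permutes {1..n}. monom 1 (weak_exc n \<sigma>))"
proof -
  let ?S = "{\<sigma>. \<sigma> permutes {1..n}}"
  have fin: "finite ?S" by (simp add: finite_permutations)
  have "(\<Sum>\<sigma>\<in>?S. monom (1::real) (weak_exc n \<sigma>)) =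
      (\<Sum>k\<le>n. \<Sum>\<sigma>\<in>{\<sigma>\<in>?S. weak_exc n \<sigma> = k}. monom 1 (weak_exc n \<sigma>))"
    by (rule sum.group[symmetric]) (use fin weak_exc_le in auto)
  also have "\<dots> = (\<Sum>k\<le>n. monom (real (eulerian_num n k)) k)"
    by (intro sum.cong refl)
      (simp add: eulerian_num_def weak_exc_def of_nat_poly smult_monom flip: of_nat_monom)
  finally show ?thesis by (simp add: eulerian_poly_def)
qed

lemma degree_eulerian_poly: "degree (eulerian_poly n) \<le> n"
  unfolding eulerian_poly_def
  by (intro degree_sum_le) (auto intro: order.trans[OF degree_monom_le])

text \<open>Every permutation of \<open>{1..n + 1}\<close> arises from a permutation \<open>q\<close> of \<open>{1..n}\<close> by splicing \<open>n + 1\<close>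
  into a cycle directly after some \<open>i\<close>, or as a fixed point if \<open>i = n + 1\<close>; composing with a
  transposition does exactly this.  Afterwards \<open>i\<close> is a weak excedance in either case, and \<open>n + 1\<close> is
  one only as a fixed point, so the count grows unless \<open>i\<close> was a weak excedance of \<open>q\<close> already.\<close>

lemma weak_exc_insert:
  assumes q: "q permutes {1..n}" and i: "i \<in> {1..Suc n}"
  shows "weak_exc (Suc n) (Transposition.transpose (Suc n) (q i) \<circ> q) =
    (if i \<le> n \<and> i \<le> q i then weak_exc n q else Suc (weak_exc n q))"
proof -
  let ?p = "Transposition.transpose (Suc n) (q i) \<circ> q"
  let ?W = "{j \<in> {1..n}. q j \<ge> j}"
  have out: "q (Suc n) = Suc n" using q by (auto simp: permutes_def)
  have inj: "q j = q i \<longleftrightarrow> j = i" for j using permutes_inj[OF q] by (auto dest: injD)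
  have le: "q j \<in> {1..n} \<longleftrightarrow> j \<in> {1..n}" for j using permutes_in_image[OF q] by blast
  have at_i: "?p i = Suc n" by simp
  have at_Suc: "?p (Suc n) = q i" by (simp add: out)
  have other: "?p j = q j" if "j \<in> {1..n}" "j \<noteq> i" for j
    using that inj[of j] le[of j] by (auto simp: Transposition.transpose_def)
  show ?thesis
  proof (cases "i = Suc n")
    case True
    have "{j \<in> {1..Suc n}. ?p j \<ge> j} = insert (Suc n) ?W"
      using True at_i other by (auto simp: le_Suc_eq)
    then show ?thesis using True by (simp add: weak_exc_def)
  next
    case False
    with i have i': "i \<in> {1..n}" by auto
    then have qi: "q i \<in> {1..n}" using le by blast
    have "j \<in> {1..Suc n} \<and> ?p j \<ge> j \<longleftrightarrow> j \<in> insert i ?W" for j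
    proof -
      consider "j = i" | "j = Suc n" | "j \<in> {1..n}" "j \<noteq> i" | "j \<notin> {1..Suc n}" by force
      then show ?thesis
      proof cases
        case 1 then show ?thesis using i' at_i by auto
      next
        case 2 then show ?thesis using False qi at_Suc by auto
      next
        case 3 then show ?thesis using other by auto
      next
        case 4 then show ?thesis using i' by auto
      qed
    qed
    then have "{j \<in> {1..Suc n}. ?p j \<ge> j} = insert i ?W" by blast
    then have "weak_exc (Suc n) ?p = card (insert i ?W)" by (simp add: weak_exc_def)
    also have "\<dots> = (if i \<le> q i then card ?W else Suc (card ?W))"
      using i' by (auto simp: insert_absorb)
    finally show ?thesis using i' by (auto simp: weak_exc_def)
  qed
qed

lemma smult_sum_right: "smult c (\<Sum>i\<in>S. f i) = (\<Sum>i\<in>S. smult c (f i))"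
  by (induction S rule: infinite_finite_induct) (auto simp: smult_add_right)

lemma pderiv_sum: "pderiv (\<Sum>i\<in>S. f i) = (\<Sum>i\<in>S. pderiv (f i))"
  using higher_pderiv_sum[of 1 f S] by simp

text \<open>A permutation with \<open>w\<close> weak excedances has, among its \<open>n + 1\<close> extensions, \<open>w\<close> with \<open>w\<close> and
  \<open>n + 1 - w\<close> with \<open>w + 1\<close> weak excedances.  The differential operator in the recurrence is the one
  that maps \<open>t\<^sup>w\<close> to \<open>w t\<^sup>w + (n + 1 - w) t\<^sup>w\<^sup>+\<^sup>1\<close>.\<close>

lemma eulerian_poly_Suc:
  "eulerian_poly (Suc n) =
    smult (real (Suc n)) (monom 1 1 * eulerian_poly n)
      + monom 1 1 * (1 - monom 1 1) * pderiv (eulerian_poly n)"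
proof -
  let ?X = "monom (1::real) 1"
  have fibre: "(\<Sum>b\<in>{1..Suc n}. monom (1::real) (weak_exc (Suc n) (Transposition.transpose (Suc n) b \<circ> q))) =
      smult (real (Suc n)) (?X * monom 1 (weak_exc n q))
        + ?X * (1 - ?X) * pderiv (monom 1 (weak_exc n q))"
    if q: "q permutes {1..n}" for q
  proof -
    let ?w = "weak_exc n q" and ?W = "{i \<in> {1..Suc n}. i \<le> n \<and> i \<le> q i}"
    have w: "card ?W = ?w" unfolding weak_exc_def by (rule arg_cong[of _ _ card]) auto
    have q': "q permutes {1..Suc n}" using q by (rule permutes_subset) auto
    \<comment> \<open>Index the extensions by the predecessor \<open>i\<close> of \<open>n + 1\<close> instead of its image \<open>b = q i\<close>.\<close>
    have "(\<Sum>b\<in>{1..Suc n}. monom (1::real) (weak_exc (Suc n) (Transposition.transpose (Suc n) b \<circ> q))) =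
        (\<Sum>i\<in>{1..Suc n}. monom 1 (weak_exc (Suc n) (Transposition.transpose (Suc n) (q i) \<circ> q)))"
      by (rule sum.reindex_bij_betw[symmetric]) (rule permutes_imp_bij[OF q'])
    also have "\<dots> = (\<Sum>i\<in>{1..Suc n}. if i \<le> n \<and> i \<le> q i then monom 1 ?w else monom 1 (Suc ?w))"
      by (intro sum.cong refl) (simp add: weak_exc_insert[OF q])
    also have "\<dots> = of_nat (card ?W) * monom 1 ?w + of_nat (card ({1..Suc n} - ?W)) * monom 1 (Suc ?w)"
    proof -
      have "{1..Suc n} \<inter> {i. i \<le> n \<and> i \<le> q i} = ?W"
        "{1..Suc n} \<inter> - {i. i \<le> n \<and> i \<le> q i} = {1..Suc n} - ?W" by auto
      then show ?thesis by (simp only: sum.If_cases finite_atLeastAtMost sum_constant)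
    qed
    also have "card ({1..Suc n} - ?W) = Suc n - ?w"
      by (subst card_Diff_subset) (auto simp: w[simplified])
    also have "of_nat (card ?W) * monom (1::real) ?w + of_nat (Suc n - ?w) * monom 1 (Suc ?w) =
        smult (real (Suc n)) (?X * monom 1 ?w) + ?X * (1 - ?X) * pderiv (monom 1 ?w)"
    proof -
      have "?w \<le> n" by (rule weak_exc_le)
      then show ?thesis unfolding w
        by (cases ?w) (auto simp: poly_eq_iff of_nat_poly coeff_monom pderiv_monom mult_monom 
            algebra_simps of_nat_diff smult_monom)
    qed
    finally show ?thesis .
  qed
  have "{1..Suc n} = insert (Suc n) {1..n}" by auto
  then have "eulerian_poly (Suc n) =
      (\<Sum>b\<in>{1..Suc n}. \<Sum>q | q permutes {1..n}. monom 1 (weak_exc (Suc n) (Transposition.transpose (Suc n) b \<circ> q)))"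
    unfolding eulerian_poly_as_sum by (simp only:) (subst sum_over_permutations_insert, auto)
  also have "\<dots> = (\<Sum>q | q permutes {1..n}. \<Sum>b\<in>{1..Suc n}.
      monom 1 (weak_exc (Suc n) (Transposition.transpose (Suc n) b \<circ> q)))"
    by (rule sum.swap)
  also have "\<dots> = (\<Sum>q | q permutes {1..n}. smult (real (Suc n)) (?X * monom 1 (weak_exc n q))
        + ?X * (1 - ?X) * pderiv (monom 1 (weak_exc n q)))"
    by (intro sum.cong refl fibre) auto
  also have "\<dots> = smult (real (Suc n)) (?X * eulerian_poly n) + ?X * (1 - ?X) * pderiv (eulerian_poly n)"
    unfolding eulerian_poly_as_sum 
    by (simp only: sum.distrib sum_distrib_left smult_sum_right pderiv_sum)
  finally show ?thesis .
qed

section \<open>Generating functions\<close>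

text \<open>The series \<open>1 / (1 - X)\<close>; working with its powers keeps all identities free of division.\<close>

definition geom :: "real fps" where
  "geom = Abs_fps (\<lambda>_. 1)"

lemma geom_mult_one_minus_X: "(1 - fps_X) * geom = 1"
  by (rule fps_ext) (simp add: geom_def left_diff_distrib)

lemma fps_deriv_geom: "fps_deriv geom = geom ^ 2"
  by (rule fps_ext) (simp add: geom_def power2_eq_square fps_mult_nth)

lemma fps_nth_geom_power_Suc: "fps_nth (geom ^ Suc d) n = real ((n + d) choose d)"
proof (induction d arbitrary: n)
  case 0
  then show ?case by (simp add: geom_def)
next
  case (Suc d)
  have "fps_nth (geom ^ Suc (Suc d)) n = (\<Sum>k=0..n. fps_nth (geom ^ Suc d) k)"
    by (subst power_Suc2) (simp add: fps_mult_nth geom_def)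
  also have "\<dots> = real (\<Sum>k\<le>n. (d + k) choose d)"
    unfolding Suc.IH by (simp add: atMost_atLeast0 add.commute)
  also have "\<dots> = real ((n + Suc d) choose Suc d)"
    using choose_rising_sum(1)[of d n] by (simp add: add.commute)
  finally show ?case .
qed

text \<open>Euler's identity.  Applying \<open>X d/dX\<close> raises the exponent of \<open>k\<close> by one, and on numerators over
  powers of \<open>1 - X\<close> it acts by the recurrence for the Eulerian polynomials.\<close>

lemma fps_powers_eq_eulerian:
  "Abs_fps (\<lambda>k. real k ^ n) = fps_of_poly (eulerian_poly n) * geom ^ Suc n"
proof (induction n)
  case 0
  have "eulerian_poly 0 = 1"
    by (simp add: eulerian_poly_as_sum weak_exc_def)
  then show ?case by (simp add: geom_def)
next
  case (Suc n)
  let ?A = "fps_of_poly (eulerian_poly n)"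
  let ?r = "fps_const (real (Suc n))"
  have "Abs_fps (\<lambda>k. real k ^ Suc n) = fps_X * fps_deriv (Abs_fps (\<lambda>k. real k ^ n))"
  proof (rule fps_ext)
    fix k show "fps_nth (Abs_fps (\<lambda>k. real k ^ Suc n)) k =
        fps_nth (fps_X * fps_deriv (Abs_fps (\<lambda>k. real k ^ n))) k"
      by (cases k) auto
  qed
  also have "\<dots> = fps_X * fps_deriv (?A * geom ^ Suc n)" by (simp only: Suc.IH)
  also have "\<dots> = fps_X * (fps_deriv ?A * geom ^ Suc n) + ?r * fps_X * ?A * geom ^ Suc (Suc n)"
    unfolding fps_deriv_mult fps_deriv_power fps_deriv_geom diff_Suc_1 power2_eq_square
    by (simp only: power_Suc distrib_left mult_ac add_ac)
  also have "geom ^ Suc n = (1 - fps_X) * geom ^ Suc (Suc n)"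
    using geom_mult_one_minus_X by (simp add: mult.assoc[symmetric])
  also have "fps_X * (fps_deriv ?A * ((1 - fps_X) * geom ^ Suc (Suc n)))
        + ?r * fps_X * ?A * geom ^ Suc (Suc n)
      = (?r * (fps_X * ?A) + fps_X * (1 - fps_X) * fps_deriv ?A) * geom ^ Suc (Suc n)"
    by (simp add: algebra_simps)
  also have "?r * (fps_X * ?A) + fps_X * (1 - fps_X) * fps_deriv ?A =
      fps_of_poly (eulerian_poly (Suc n))"
    unfolding eulerian_poly_Suc
    by (simp only: fps_of_poly_add fps_of_poly_smult fps_of_poly_mult fps_of_poly_diff
        fps_of_poly_pderiv fps_of_poly_monom' fps_of_poly_1 power_one_right)
  finally show ?case .
qed

text \<open>The binomial factor for \<open>j\<close> is a coefficient of \<open>X\<^sup>j / (1 - X)\<^sup>d\<^sup>+\<^sup>1\<close>, since the binomial coefficient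
  vanishes for \<open>n < j \<le> d\<close>.\<close>

lemma binomial_basis_eq_fps_nth:
  assumes "degree h \<le> d"
  shows "(\<Sum>j\<le>d. coeff h j * real ((n + d - j) choose d)) =
    fps_nth (fps_of_poly h * geom ^ Suc d) n"
proof -
  let ?f = "\<lambda>j. if j \<le> n then coeff h j * real ((n + d - j) choose d) else 0"
  have "(\<Sum>j\<le>d. coeff h j * real ((n + d - j) choose d)) = (\<Sum>j\<le>d. ?f j)"
    by (intro sum.cong refl) (auto simp: not_le)
  also have "\<dots> = (\<Sum>j\<le>max n d. ?f j)"
    by (rule sum.mono_neutral_left) (use assms in \<open>auto simp: coeff_eq_0\<close>)
  also have "\<dots> = (\<Sum>j\<le>n. ?f j)"
    by (rule sum.mono_neutral_right) auto
  also have "\<dots> = fps_nth (fps_of_poly h * geom ^ Suc d) n"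
    unfolding fps_mult_nth fps_nth_geom_power_Suc atMost_atLeast0
    by (intro sum.cong refl) auto
  finally show ?thesis .
qed

text \<open>Multiplication by a power of \<open>1 / (1 - X)\<close> is injective, so the expansion in the basis
  \<open>(n + d - j choose d)\<close> determines its coefficients.\<close>

lemma binomial_basis_inject:
  assumes "degree g \<le> d" "degree h \<le> d"
    and "\<And>n. (\<Sum>j\<le>d. coeff g j * real ((n + d - j) choose d)) =
      (\<Sum>j\<le>d. coeff h j * real ((n + d - j) choose d))"
  shows "g = h"
proof -
  have eq: "fps_of_poly g * geom ^ Suc d = fps_of_poly h * geom ^ Suc d"
    using assms by (intro fps_ext) (simp add: binomial_basis_eq_fps_nth del: power_Suc)
  have "geom \<noteq> 0" using geom_mult_one_minus_X by auto
  with eq show ?thesis by (simp add: fps_of_poly_eq_iff)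
qed

lemma binomial_shift_poly:
  assumes "j \<le> d"
  shows "\<exists>p. \<forall>n::nat. poly p (real n) = real ((n + d - j) choose d)"
proof (intro exI allI)
  fix n
  have "real (n + d - j) = real n + real d - real j" using assms by (simp add: of_nat_diff)
  then have "real ((n + d - j) choose d) = (\<Prod>i<d. real n + real d - real j - real i) / fact d"
    by (simp add: binomial_gbinomial gbinomial_prod_rev atLeast0LessThan)
  then show "poly (smult (1 / fact d) (\<Prod>i<d. [:real d - real j - real i, 1:])) (real n) =
      real ((n + d - j) choose d)"
    by (simp add: poly_prod algebra_simps)
qed

lemma poly_eqI_nat:
  fixes p q :: "real poly"
  assumes "\<And>n::nat. poly p (real n) = poly q (real n)"
  shows "p = q"
proof (rule ccontr)
  assume "p \<noteq> q"
  then have "finite {x. poly (p - q) x = 0}" by (intro poly_roots_finite) simp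
  moreover have "range real \<subseteq> {x. poly (p - q) x = 0}" using assms by auto
  ultimately have "finite (range real)" by (rule rev_finite_subset)
  then show False using finite_imageD[of real UNIV] by (simp add: inj_on_def)
qed

text \<open>Both definite descriptions behind \<open>hstar_poly\<close> are discharged here: the expansion in shifted
  binomial coefficients shows that the lattice point count is a polynomial in \<open>n\<close>, which provides the
  Ehrhart polynomial without appeal to Ehrhart's theorem, and the coefficients are unique.\<close>

lemma hstar_poly_eqI:
  fixes P :: "(real ^ 'n) set"
  assumes deg: "degree h \<le> CARD('n)"
    and count: "\<And>n. real (card ((\<lambda>x. real n *\<^sub>R x) ` P \<inter> integer_lattice)) =
      fps_nth (fps_of_poly h * geom ^ Suc CARD('n)) n"
  shows "hstar_poly P = h"
proof -
  let ?d = "CARD('n)"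
  let ?B = "\<lambda>n. \<Sum>j\<le>?d. coeff h j * real ((n + ?d - j) choose ?d)"
  have count': "real (card ((\<lambda>x. real n *\<^sub>R x) ` P \<inter> integer_lattice)) = ?B n" for n
    by (simp only: count binomial_basis_eq_fps_nth[OF deg])
  obtain b where b: "\<And>j n. j \<le> ?d \<Longrightarrow> poly (b j) (real n) = real ((n + ?d - j) choose ?d)"
    using binomial_shift_poly[of _ ?d] by metis
  let ?E = "\<Sum>j\<le>?d. smult (coeff h j) (b j)"
  have E: "poly ?E (real n) = ?B n" for n
    by (simp add: poly_sum b)
  have "ehrhart_poly P = ?E"
    unfolding ehrhart_poly_def by (rule the_equality) (auto simp: E count' intro!: poly_eqI_nat)
  then show ?thesis
    unfolding hstar_poly_def
    by (intro the_equality) (use deg E in \<open>auto intro!: binomial_basis_inject[of _ ?d]\<close>)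
qed

section \<open>Counting integer points by their negative part\<close>

text \<open>Generating functions by weight multiply over independent coordinates.  Finiteness is carried
  along because the sets \<open>A i\<close> may be infinite and only their weight classes are finite.\<close>

lemma finite_card_PiE_weight:
  fixes A :: "'a \<Rightarrow> 'b set" and w :: "'a \<Rightarrow> 'b \<Rightarrow> nat"
  assumes "finite I" and fin: "\<And>i m. i \<in> I \<Longrightarrow> finite {y \<in> A i. w i y = m}"
  shows "finite {f \<in> PiE I A. (\<Sum>i\<in>I. w i (f i)) = m} \<and>
    real (card {f \<in> PiE I A. (\<Sum>i\<in>I. w i (f i)) = m}) =
      fps_nth (\<Prod>i\<in>I. Abs_fps (\<lambda>m. real (card {y \<in> A i. w i y = m}))) m"
  using assms
proof (induction I arbitrary: m rule: finite_induct)
  case empty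
  have "{f \<in> PiE {} A. (\<Sum>i\<in>{}. w i (f i)) = m} = (if m = 0 then {\<lambda>_. undefined} else {})"
    by auto
  then show ?case by simp
next
  case (insert a I)
  let ?S = "\<lambda>m. {f \<in> PiE I A. (\<Sum>i\<in>I. w i (f i)) = m}"
  let ?Y = "\<lambda>m. {y \<in> A a. w a y = m}"
  let ?T = "{f \<in> PiE (insert a I) A. (\<Sum>i\<in>insert a I. w i (f i)) = m}"
  let ?D = "SIGMA l:{0..m}. ?Y l \<times> ?S (m - l)"
  let ?g = "\<lambda>(l::nat, y, f). f(a := y)"
  have upd: "(\<Sum>i\<in>I. w i ((f(a := y)) i)) = (\<Sum>i\<in>I. w i (f i))" for f y
    using insert.hyps by (intro sum.cong) auto
  let ?h = "\<lambda>x. (w a (x a), x a, x(a := undefined))"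
  have bij: "bij_betw ?g ?D ?T"
  proof (rule bij_betwI[where g = ?h])
    show "?g \<in> ?D \<rightarrow> ?T"
    proof (rule funcsetI, erule SigmaE)
      fix z l yf assume z: "l \<in> {0..m}" "yf \<in> ?Y l \<times> ?S (m - l)" "z = (l, yf)"
      obtain y f where yf: "yf = (y, f)" by fastforce
      have *: "y \<in> A a" "w a y = l" "f \<in> PiE I A" "(\<Sum>i\<in>I. w i (f i)) = m - l" "l \<le> m"
        using z yf by auto
      have "f(a := y) \<in> PiE (insert a I) A" using *(1,3) by (rule PiE_fun_upd)
      moreover have "(\<Sum>i\<in>insert a I. w i ((f(a := y)) i)) = m"
        unfolding sum.insert[OF insert.hyps] upd using * by simp
      ultimately show "?g z \<in> ?T" by (simp add: z yf)
    qed
    show "?h \<in> ?T \<rightarrow> ?D"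
    proof (rule funcsetI)
      fix x assume x: "x \<in> ?T"
      then have "x a \<in> A a" "x(a := undefined) \<in> PiE I A"
        using insert.hyps(2) by (auto simp: PiE_iff extensional_def)
      moreover have "w a (x a) + (\<Sum>i\<in>I. w i (x i)) = m"
        using x sum.insert[OF insert.hyps, of "\<lambda>i. w i (x i)"] by simp
      ultimately show "?h x \<in> ?D" unfolding mem_Sigma_iff mem_Times_iff mem_Collect_eq fst_conv snd_conv upd
        by simp
    qed
    show "?h (?g z) = z" if "z \<in> ?D" for z
    proof -
      obtain l y f where z: "z = (l, y, f)" by (rule prod_cases3)
      with that have l: "w a y = l" and f: "f \<in> PiE I A" by auto
      have "f(a := undefined) = f" using PiE_arb[OF f insert.hyps(2)] by (rule fun_upd_idem)
      then show ?thesis by (simp only: z l split fun_upd_same fun_upd_upd)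
    qed
    show "?g (?h x) = x" for x by simp
  qed
  have IH: "finite (?S l) \<and> real (card (?S l)) =
      fps_nth (\<Prod>i\<in>I. Abs_fps (\<lambda>m. real (card {y \<in> A i. w i y = m}))) l" for l
    by (rule insert.IH) (rule insert.prems, simp)
  note finS = IH[THEN conjunct1] and cardS = IH[THEN conjunct2]
  have finY: "finite (?Y l)" for l by (rule insert.prems) simp
  have "finite ?D" using finS finY by (intro finite_SigmaI) auto
  moreover have "card ?D = (\<Sum>l=0..m. card (?Y l) * card (?S (m - l)))"
    using finS finY by (subst card_SigmaI) (auto simp: card_cartesian_product)
  ultimately have "finite ?T" and "real (card ?T) =
      (\<Sum>l=0..m. real (card (?Y l)) * real (card (?S (m - l))))"
    using bij_betw_finite[OF bij] bij_betw_same_card[OF bij] by simp_all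
  then show ?case
    unfolding prod.insert[OF insert.hyps] fps_mult_nth cardS by simp
qed

lemma degree_prod_linear_le:
  fixes a :: "'a \<Rightarrow> real"
  assumes "finite I"
  shows "degree (\<Prod>i\<in>I. [:1, a i:]) \<le> card I"
proof -
  have "degree (\<Prod>i\<in>I. [:1, a i:]) \<le> (\<Sum>i\<in>I. degree [:1, a i:])"
    using degree_prod_sum_le[OF assms, of "\<lambda>i. [:1, a i:]"] by (simp add: o_def)
  also have "\<dots> \<le> (\<Sum>i\<in>I. 1)" by (rule sum_mono) simp
  finally show ?thesis by simp
qed

text \<open>Homogenisation: substituting \<open>x / y\<close> into \<open>\<Prod>\<^sub>i (1 + a\<^sub>i t)\<close> and clearing the denominators, one
  factor \<open>y\<close> for each \<open>i\<close>.\<close>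

lemma prod_homogenize:
  fixes a :: "'a \<Rightarrow> real" and x y :: "real fps"
  assumes "finite I"
  shows "(\<Prod>i\<in>I. fps_const (a i) * x + y) =
    (\<Sum>j\<le>card I. fps_const (coeff (\<Prod>i\<in>I. [:1, a i:]) j) * x ^ j * y ^ (card I - j))"
  using assms
proof (induction I rule: finite_induct)
  case empty
  then show ?case by simp
next
  case (insert i I)
  define p m where "p = (\<Prod>i\<in>I. [:1, a i:])" and "m = card I"
  define T where "T = (\<Sum>j\<le>m. fps_const (coeff p j) * x ^ j * y ^ (m - j))"
  have deg: "degree p \<le> m"
    unfolding p_def m_def by (rule degree_prod_linear_le) (rule insert.hyps)
  have IH: "(\<Prod>i\<in>I. fps_const (a i) * x + y) = T"
    using insert.IH by (simp add: p_def m_def T_def)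
  have split: "[:1, a i:] * p = p + pCons 0 (smult (a i) p)" by simp
  have "(\<Sum>j\<le>Suc m. fps_const (coeff p j) * x ^ j * y ^ (Suc m - j)) =
      (\<Sum>j\<le>m. fps_const (coeff p j) * x ^ j * y ^ (Suc m - j))"
    using deg by (simp add: coeff_eq_0)
  also have "\<dots> = y * T"
    unfolding T_def sum_distrib_left by (intro sum.cong refl) (simp add: Suc_diff_le mult_ac)
  finally have low: "(\<Sum>j\<le>Suc m. fps_const (coeff p j) * x ^ j * y ^ (Suc m - j)) = y * T" .
  have high: "(\<Sum>j\<le>Suc m. fps_const (coeff (pCons 0 (smult (a i) p)) j) * x ^ j * y ^ (Suc m - j))
      = fps_const (a i) * x * T"
    unfolding sum.atMost_Suc_shift T_def sum_distrib_left
    by (simp add: mult_ac flip: fps_const_mult)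
  have "(\<Sum>j\<le>Suc m. fps_const (coeff ([:1, a i:] * p) j) * x ^ j * y ^ (Suc m - j)) =
      y * T + fps_const (a i) * x * T"
    unfolding split coeff_add fps_const_add[symmetric] distrib_right sum.distrib low high ..
  then show ?case
    unfolding prod.insert[OF insert.hyps] card_insert_disjoint[OF insert.hyps] IH
    unfolding p_def[symmetric] m_def[symmetric] by (simp add: distrib_right add.commute)
qed

text \<open>Weight 0 collects the \<open>t + 1\<close> values \<open>0, \<dots>, t\<close>, every other weight has one value.\<close>

lemma fps_bounded_above_negative_part:
  "Abs_fps (\<lambda>m. real (card {y \<in> {..int t}. nat (- y) = m})) = fps_const (real t) + geom"
proof (rule fps_ext)
  fix m
  show "fps_nth (Abs_fps (\<lambda>m. real (card {y \<in> {..int t}. nat (- y) = m}))) m =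
      fps_nth (fps_const (real t) + geom) m"
  proof (cases m)
    case 0
    have "{y \<in> {..int t}. nat (- y) = 0} = {0..int t}" by auto
    with 0 show ?thesis by (simp add: geom_def)
  next
    case (Suc k)
    then have "{y \<in> {..int t}. nat (- y) = m} = {- int m}" by auto
    with Suc show ?thesis by (simp add: geom_def)
  qed
qed

lemma finite_bounded_above_negative_part: "finite {y \<in> {..int t}. nat (- y) = m}"
  by (rule finite_subset[of _ "{- int m..int t}"]) auto

text \<open>The integer points of the dilate by \<open>k + m\<close> whose negative coordinates add up to \<open>- m\<close>.\<close>

definition lattice_slice :: "('n::finite \<Rightarrow> nat) \<Rightarrow> nat \<Rightarrow> nat \<Rightarrow> ('n \<Rightarrow> int) set" where
  "lattice_slice \<theta> k m = {y. (\<forall>i. y i \<le> int (\<theta> i * k)) \<and> (\<Sum>i\<in>UNIV. nat (- y i)) = m}"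

lemma card_lattice_slice:
  "finite (lattice_slice \<theta> k m)"
  "real (card (lattice_slice \<theta> k m)) =
    fps_nth (\<Prod>i\<in>UNIV. fps_const (real (\<theta> i)) * fps_const (real k) + geom) m"
proof -
  define t where "t i = \<theta> i * k" for i
  have slice: "lattice_slice \<theta> k m =
     {y \<in> PiE UNIV (\<lambda>i. {..int (t i)}). (\<Sum>i\<in>UNIV. nat (- y i)) = m}"
    by (auto simp: lattice_slice_def PiE_iff t_def)
  have factor: "fps_const (real (\<theta> i)) * fps_const (real k) = fps_const (real (t i))" for i
    by (simp add: t_def)
  note count = finite_card_PiE_weight[of UNIV "\<lambda>i. {..int (t i)}" "\<lambda>_ y. nat (- y)" m,
    OF _ finite_bounded_above_negative_part, unfolded fps_bounded_above_negative_part]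
  show "finite (lattice_slice \<theta> k m)"
    unfolding slice using count by simp
  show "real (card (lattice_slice \<theta> k m)) =
      fps_nth (\<Prod>i\<in>UNIV. fps_const (real (\<theta> i)) * fps_const (real k) + geom) m"
    unfolding slice factor using count by simp
qed

lemma sum_card_lattice_slices:
  fixes \<theta> :: "'n::finite \<Rightarrow> nat"
  shows "(\<Sum>k\<le>n. real (card (lattice_slice \<theta> k (n - k)))) =
    fps_nth (fps_of_poly (eulerian_map (\<Prod>i\<in>UNIV. [:1, real (\<theta> i):])) * geom ^ Suc CARD('n)) n"
proof -
  let ?d = "CARD('n)" and ?p = "\<Prod>i\<in>UNIV. [:1, real (\<theta> i):]"
  have deg: "degree ?p \<le> ?d"
    using degree_prod_linear_le[of UNIV "\<lambda>i. real (\<theta> i)"] by simp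
  have "real (card (lattice_slice \<theta> k (n - k))) =
      (\<Sum>j\<le>?d. coeff ?p j * (real k ^ j * fps_nth (geom ^ (?d - j)) (n - k)))" for k
  proof -
    have "real (card (lattice_slice \<theta> k (n - k))) =
       fps_nth (\<Sum>j\<le>?d. fps_const (coeff ?p j) * fps_const (real k) ^ j * geom ^ (?d - j)) (n - k)"
      using prod_homogenize[of UNIV "\<lambda>i. real (\<theta> i)" "fps_const (real k)" geom]
      by (simp add: card_lattice_slice)
    then show ?thesis
      by (simp add: fps_sum_nth mult.assoc fps_const_power)
  qed
  then have "(\<Sum>k\<le>n. real (card (lattice_slice \<theta> k (n - k)))) =
      (\<Sum>j\<le>?d. coeff ?p j * (\<Sum>k\<le>n. real k ^ j * fps_nth (geom ^ (?d - j)) (n - k)))"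
    by (simp add: sum_distrib_left sum.swap[of _ "{..n}"])
  also have "\<dots> = (\<Sum>j\<le>?d. coeff ?p j * fps_nth (Abs_fps (\<lambda>k. real k ^ j) * geom ^ (?d - j)) n)"
    by (simp add: fps_mult_nth atMost_atLeast0)
  also have "\<dots> = (\<Sum>j\<le>?d. coeff ?p j * fps_nth (fps_of_poly (eulerian_poly j) * geom ^ Suc ?d) n)"
    by (intro sum.cong refl)
      (simp add: fps_powers_eq_eulerian mult.assoc flip: power_add power_Suc)
  also have "\<dots> = fps_nth (fps_of_poly (eulerian_map ?p) * geom ^ Suc ?d) n"
    unfolding eulerian_map_bound[OF deg]
    by (simp add: fps_of_poly_sum fps_of_poly_smult sum_distrib_right fps_sum_nth mult.assoc
        del: power_Suc)
  finally show ?thesis .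
qed

lemma degree_eulerian_map: "degree (eulerian_map p) \<le> degree p"
  unfolding eulerian_map_def
  by (intro degree_sum_le)
    (auto intro: order.trans[OF degree_smult_le] order.trans[OF degree_eulerian_poly])

section \<open>The lattice points of the dilated polytope\<close>

lemma neg_std_simplex:
  "uminus ` std_simplex = {x :: real ^ 'n. (\<forall>i. x $ i \<le> 0) \<and> (\<Sum>i\<in>UNIV. - x $ i) \<le> 1}"
proof -
  have B: "range (\<lambda>i. axis i 1) = (Basis :: (real ^ 'n) set)"
    by (auto simp: Basis_vec_def)
  have inj: "inj (\<lambda>i::'n. axis i (1::real))" by (auto simp: inj_on_def axis_eq_axis)
  have S: "std_simplex = {x :: real ^ 'n. (\<forall>i. 0 \<le> x $ i) \<and> (\<Sum>i\<in>UNIV. x $ i) \<le> 1}"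
    unfolding std_simplex_def B std_simplex
    unfolding B[symmetric] sum.reindex[OF inj] by (simp add: inner_axis)
  show ?thesis unfolding S
  proof (intro equalityI subsetI)
    fix x :: "real ^ 'n"
    assume "x \<in> {x. (\<forall>i. x $ i \<le> 0) \<and> (\<Sum>i\<in>UNIV. - x $ i) \<le> 1}"
    then show "x \<in> uminus ` {x. (\<forall>i. 0 \<le> x $ i) \<and> (\<Sum>i\<in>UNIV. x $ i) \<le> 1}"
      by (intro image_eqI[of _ _ "- x"]) auto
  qed auto
qed

text \<open>The unknown \<open>u\<close> is the total weight on the reflected simplex and \<open>- a\<close> the contribution of that
  simplex, already scaled by \<open>u\<close>; in this form the criterion is linear in \<open>a\<close> and \<open>u\<close>.\<close>

lemma mem_polytope_P_iff:
  fixes p :: "real ^ 'n"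
  shows "p \<in> polytope_P \<theta> \<longleftrightarrow>
    (\<exists>u a. 0 \<le> u \<and> u \<le> 1 \<and> (\<forall>i. 0 \<le> a i) \<and> (\<Sum>i\<in>UNIV. a i) \<le> u \<and>
      (\<forall>i. 0 \<le> p $ i + a i \<and> p $ i + a i \<le> (1 - u) * real (\<theta> i)))"
    (is "_ \<longleftrightarrow> ?R")
proof -
  let ?S = "uminus ` std_simplex :: (real ^ 'n) set" and ?Q = "box_Q \<theta>"
  have "convex ?S"
    by (intro convex_negations) (simp add: std_simplex_def convex_convex_hull)
  moreover have "0 \<in> ?S" by (simp add: neg_std_simplex)
  moreover have "convex ?Q"
  proof -
    have "?Q = cbox 0 (\<chi> i. real (\<theta> i))" by (auto simp: box_Q_def mem_box_cart)
    then show ?thesis by (metis convex_box(1))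
  qed
  moreover have "0 \<in> ?Q" by (simp add: box_Q_def)
  ultimately have hull: "polytope_P \<theta> =
      {u *\<^sub>R s + v *\<^sub>R q | u v s q. u \<ge> 0 \<and> v \<ge> 0 \<and> u + v = 1 \<and> s \<in> ?S \<and> q \<in> ?Q}"
    unfolding polytope_P_def by (intro convex_hull_union_two) auto
  show ?thesis
  proof
    assume "p \<in> polytope_P \<theta>"
    then obtain u v s q where *: "0 \<le> u" "0 \<le> v" "u + v = 1" "s \<in> ?S" "q \<in> ?Q"
      "p = u *\<^sub>R s + v *\<^sub>R q" unfolding hull by blast
    then have v: "v = 1 - u" by simp
    have "(\<Sum>i\<in>UNIV. u * (- s $ i)) \<le> u"
      using *(1,4) unfolding sum_distrib_left[symmetric]
      by (simp add: neg_std_simplex mult_left_le)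
    then show ?R
      using * by (intro exI[of _ u] exI[of _ "\<lambda>i. u * (- s $ i)"])
        (auto simp: neg_std_simplex box_Q_def v mult_nonneg_nonpos intro!: mult_left_mono)
  next
    assume ?R
    then obtain u a where *: "0 \<le> u" "u \<le> 1" "\<And>i. 0 \<le> a i" "(\<Sum>i\<in>UNIV. a i) \<le> u"
      "\<And>i. 0 \<le> p $ i + a i" "\<And>i. p $ i + a i \<le> (1 - u) * real (\<theta> i)" by blast
    \<comment> \<open>At \<open>u = 0\<close> and \<open>u = 1\<close> the vector divided by zero vanishes, so the value 0 of the quotient is right.\<close>
    define s q where "s = (\<chi> i. - (a i / u))" and "q = (\<chi> i. (p $ i + a i) / (1 - u))"
    have a0: "a i = 0" if "u = 0" for i
    proof -
      have "a i \<le> (\<Sum>i\<in>UNIV. a i)" by (rule member_le_sum) (use * in auto)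
      then show ?thesis using * that by (simp add: order.antisym)
    qed
    have p0: "p $ i + a i = 0" if "u = 1" for i
      using *(5,6)[of i] that by simp
    have "s \<in> ?S"
      using * by (auto simp: neg_std_simplex s_def sum_divide_distrib[symmetric] divide_le_eq_1)
    moreover have "q \<in> ?Q"
    proof (cases "u = 1")
      case False
      then show ?thesis using * by (auto simp: box_Q_def q_def divide_simps mult.commute)
    qed (simp add: box_Q_def q_def)
    moreover have "p = u *\<^sub>R s + (1 - u) *\<^sub>R q"
    proof -
      have "p $ i = u * (- (a i / u)) + (1 - u) * ((p $ i + a i) / (1 - u))" for i
        using a0[of i] p0[of i] by (cases "u = 0"; cases "u = 1") auto
      then show ?thesis by (simp add: vec_eq_iff s_def q_def)
    qed
    ultimately show "p \<in> polytope_P \<theta>"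
      unfolding hull using *(1,2) by (intro CollectI exI[of _ u] exI[of _ "1 - u"]) auto
  qed
qed

text \<open>Any admissible \<open>a\<close> dominates the negative part of the point, and the negative part itself is
  admissible whenever some \<open>a\<close> is, with \<open>u = m / n\<close> as the smallest possible weight.\<close>

lemma int_point_mem_dilate_iff:
  fixes y :: "'n::finite \<Rightarrow> int"
  defines "m \<equiv> \<Sum>i\<in>UNIV. nat (- y i)"
  shows "(\<chi> i. real_of_int (y i)) \<in> (\<lambda>x. real n *\<^sub>R x) ` polytope_P \<theta> \<longleftrightarrow>
    m \<le> n \<and> (\<forall>i. y i \<le> int (\<theta> i * (n - m)))"
proof
  assume "(\<chi> i. real_of_int (y i)) \<in> (\<lambda>x. real n *\<^sub>R x) ` polytope_P \<theta>"
  then obtain p where p: "p \<in> polytope_P \<theta>" and yp: "\<And>i. real_of_int (y i) = real n * p $ i"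
    by (auto simp: vec_eq_iff)
  from p obtain u a where *: "0 \<le> u" "u \<le> 1" "\<And>i. 0 \<le> a i" "(\<Sum>i\<in>UNIV. a i) \<le> u"
      "\<And>i. 0 \<le> p $ i + a i" "\<And>i. p $ i + a i \<le> (1 - u) * real (\<theta> i)"
    unfolding mem_polytope_P_iff by blast
  have "real (nat (- y i)) \<le> real n * a i" for i
  proof -
    have "0 \<le> real n * a i" "- real_of_int (y i) \<le> real n * a i"
      using *(3)[of i] mult_left_mono[OF *(5)[of i], of "real n"] by (auto simp: yp algebra_simps)
    then show ?thesis by (cases "y i \<ge> 0") auto
  qed
  then have "real m \<le> (\<Sum>i\<in>UNIV. real n * a i)"
    unfolding m_def of_nat_sum by (rule sum_mono)
  also have "\<dots> \<le> real n * u"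
    unfolding sum_distrib_left[symmetric] using *(4) by (intro mult_left_mono) auto
  finally have mu: "real m \<le> real n * u" .
  also have "\<dots> \<le> real n" using *(1,2) by (simp add: mult_left_le)
  finally have mn: "m \<le> n" by simp
  have "y i \<le> int (\<theta> i * (n - m))" for i
  proof -
    have "p $ i \<le> (1 - u) * real (\<theta> i)" using *(3,6)[of i] by linarith
    then have "real_of_int (y i) \<le> real n * ((1 - u) * real (\<theta> i))"
      unfolding yp by (rule mult_left_mono) simp
    also have "\<dots> = (real n - real n * u) * real (\<theta> i)" by (simp add: algebra_simps)
    also have "\<dots> \<le> (real n - real m) * real (\<theta> i)" using mu by (intro mult_right_mono) auto
    also have "\<dots> = real_of_int (int (\<theta> i * (n - m)))" using mn by (simp add: of_nat_diff)
    finally show ?thesis by (simp only: of_int_le_iff)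
  qed
  with mn show "m \<le> n \<and> (\<forall>i. y i \<le> int (\<theta> i * (n - m)))" by blast
next
  assume R: "m \<le> n \<and> (\<forall>i. y i \<le> int (\<theta> i * (n - m)))"
  define p :: "real ^ 'n" where "p = (\<chi> i. real_of_int (y i) / real n)"
  \<comment> \<open>For \<open>n = 0\<close> the point \<open>p\<close> is the origin, which is where \<open>y\<close> has to be.\<close>
  have y0: "y i = 0" if "n = 0" for i
  proof -
    have "nat (- y i) = 0" using R that by (simp add: m_def)
    then show ?thesis using R that by (simp add: order.antisym)
  qed
  have bound: "real_of_int (y i) \<le> (real n - real m) * real (\<theta> i)" for i
  proof -
    have "real_of_int (y i) \<le> real_of_int (int (\<theta> i * (n - m)))" using R by (simp only: of_int_le_iff)
    then show ?thesis using R by (simp add: of_nat_diff mult.commute)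
  qed
  have "p \<in> polytope_P \<theta>"
    unfolding mem_polytope_P_iff
  proof (intro exI[of _ "real m / real n"] exI[of _ "\<lambda>i. real (nat (- y i)) / real n"] conjI allI)
    fix i
    have eq: "p $ i + real (nat (- y i)) / real n = real (nat (y i)) / real n"
      by (cases "y i \<ge> 0") (auto simp: p_def)
    show "0 \<le> p $ i + real (nat (- y i)) / real n" unfolding eq by simp
    show "p $ i + real (nat (- y i)) / real n \<le> (1 - real m / real n) * real (\<theta> i)"
    proof (cases "n = 0")
      case False
      have "real (nat (y i)) \<le> (real n - real m) * real (\<theta> i)"
        using bound[of i] R by (cases "y i \<ge> 0") auto
      then have "real (nat (y i)) / real n \<le> (real n - real m) * real (\<theta> i) / real n"
        by (rule divide_right_mono) simp
      then show ?thesis unfolding eq using False by (simp add: field_simps)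
    qed (simp add: p_def)
  next
    show "(\<Sum>i\<in>UNIV. real (nat (- y i)) / real n) \<le> real m / real n"
      by (simp add: m_def sum_divide_distrib[symmetric])
  qed (use R in \<open>auto simp: divide_le_eq_1\<close>)
  moreover have "(\<chi> i. real_of_int (y i)) = real n *\<^sub>R p"
    by (cases "n = 0") (auto simp: vec_eq_iff p_def y0)
  ultimately show "(\<chi> i. real_of_int (y i)) \<in> (\<lambda>x. real n *\<^sub>R x) ` polytope_P \<theta>" by blast
qed

lemma image_range_Int: "S \<inter> range v = v ` {y. v y \<in> S}"
  by blast

lemma card_lattice_points:
  fixes \<theta> :: "'n::finite \<Rightarrow> nat"
  shows "card ((\<lambda>x. real n *\<^sub>R x) ` polytope_P \<theta> \<inter> integer_lattice) =
    (\<Sum>k\<le>n. card (lattice_slice \<theta> k (n - k)))"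
proof -
  let ?v = "\<lambda>y::'n \<Rightarrow> int. \<chi> i. real_of_int (y i)"
  let ?U = "\<Union>k\<le>n. lattice_slice \<theta> k (n - k)"
  have lattice: "integer_lattice = range ?v"
  proof (intro equalityI subsetI)
    fix x :: "real ^ 'n"
    assume "x \<in> integer_lattice"
    then have "x = ?v (\<lambda>i. \<lfloor>x $ i\<rfloor>)" by (simp add: vec_eq_iff integer_lattice_def)
    then show "x \<in> range ?v" by (rule range_eqI[where f = ?v])
  qed (auto simp: integer_lattice_def)
  have mem: "?v y \<in> (\<lambda>x. real n *\<^sub>R x) ` polytope_P \<theta> \<longleftrightarrow> y \<in> ?U" for y
  proof -
    let ?m = "\<Sum>i\<in>UNIV. nat (- y i)"
    have ex: "(\<exists>k\<le>n. Q k \<and> l = n - k) \<longleftrightarrow> l \<le> n \<and> Q (n - l)" for Q and l :: nat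
      by (metis diff_diff_cancel diff_le_self)
    have "y \<in> ?U \<longleftrightarrow> (\<exists>k\<le>n. (\<forall>i. y i \<le> int (\<theta> i * k)) \<and> ?m = n - k)"
      by (auto simp: lattice_slice_def)
    also have "\<dots> \<longleftrightarrow> ?m \<le> n \<and> (\<forall>i. y i \<le> int (\<theta> i * (n - ?m)))"
      by (rule ex)
    finally show ?thesis by (simp only: int_point_mem_dilate_iff)
  qed
  have "(\<lambda>x. real n *\<^sub>R x) ` polytope_P \<theta> \<inter> integer_lattice =
      ?v ` {y. ?v y \<in> (\<lambda>x. real n *\<^sub>R x) ` polytope_P \<theta>}"
    unfolding lattice by (rule image_range_Int)
  also have "\<dots> = ?v ` ?U" unfolding mem Collect_mem_eq ..
  finally have "(\<lambda>x. real n *\<^sub>R x) ` polytope_P \<theta> \<inter> integer_lattice = ?v ` ?U" .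
  moreover have "inj ?v" by (auto simp: inj_on_def vec_eq_iff)
  ultimately have "card ((\<lambda>x. real n *\<^sub>R x) ` polytope_P \<theta> \<inter> integer_lattice) = card ?U"
    by (simp add: card_image inj_on_subset)
  also have "\<dots> = (\<Sum>k\<le>n. card (lattice_slice \<theta> k (n - k)))"
    by (rule card_UN_disjoint) (auto simp: card_lattice_slice(1), auto simp: lattice_slice_def)
  finally show ?thesis .
qed

theorem theorem6p3:
  fixes \<theta> :: "'n::finite \<Rightarrow> nat"
  assumes "\<And>i. \<theta> i > 0"
  shows "hstar_poly (polytope_P \<theta>) = eulerian_map (\<Prod>i\<in>UNIV. [:1, real (\<theta> i):])"
proof (rule hstar_poly_eqI)
  show "degree (eulerian_map (\<Prod>i\<in>UNIV. [:1, real (\<theta> i):])) \<le> CARD('n)"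
    using degree_prod_linear_le[of UNIV "\<lambda>i. real (\<theta> i)"] order.trans[OF degree_eulerian_map] by auto
  show "real (card ((\<lambda>x. real n *\<^sub>R x) ` polytope_P \<theta> \<inter> integer_lattice)) =
      fps_nth (fps_of_poly (eulerian_map (\<Prod>i\<in>UNIV. [:1, real (\<theta> i):])) * geom ^ Suc CARD('n)) n" for n
    by (simp only: card_lattice_points of_nat_sum sum_card_lattice_slices)
qed

end
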